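(* Let $n,m$ be positive integers and let $T:\mathbf{M}_{n,m}\to\mathbf{M}_{n,m}$ be a linear operator. Then $T$ strongly preserves gw-majorization if and only if there exist an invertible matrix $A\in\mathbf{GR}_n$ and an invertible matrix $B\in\mathbf{M}_m$ such that $T(X)=AXB$ for every $X\in\mathbf{M}_{n,m}$.
   Context: $\mathbb{F}$ is the field of real numbers or the field of complex numbers. $\mathbf{M}_{n,m}$ is the $\mathbb{F}$-vector space of all $n\times m$ matrices with entries in $\mathbb{F}$, and $\mathbf{M}_n=\mathbf{M}_{n,n}$. Let $e=(1,\dots,1)^t\in\mathbb{F}^n$. A matrix $R\in\mathbf{M}_n$ is called g-row stochastic (generalized row stochastic) if $Re=e$ (no nonnegativity is required); $\mathbf{GR}_n$ denotes the set of all $n\times n$ g-row stochastic matrices. For $A,B\in\mathbf{M}_{n,m}$, $B$ is said to be gw-majorized by $A$, written $A\succ_{gw}B$, if there exists $R\in\mathbf{GR}_n$ such that $B=RA$. A linear operator $T:\mathbf{M}_{n,m}\to\mathbf{M}_{n,m}$ strongly preserves gw-majorization if for all $X,Y\in\mathbf{M}_{n,m}$: $X\succ_{gw}Y$ if and only if $T(X)\succ_{gw}T(Y)$. *)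

theory Defs
  imports "HOL-Analysis.Analysis"
begin

text \<open>
  An \<open>n \<times> m\<close> matrix over \<open>\<F>\<close> has type \<open>'a^'m^'n\<close>: the row index type \<open>'n\<close> is the outer one.
  The definitions make sense over any field \<open>'a\<close>; the theorem instantiates
  them to \<open>real\<close> and to \<open>complex\<close>.
\<close>

definition matrix_scale :: "'a::field \<Rightarrow> 'a^'m^'n \<Rightarrow> 'a^'m^'n" where
  "matrix_scale c X = map_matrix ((*) c) X"

text \<open>
  The scalars are those of the entry type \<open>'a\<close>. For \<open>'a = complex\<close> this is complex linearity,
  whereas the unqualified library constant \<open>linear\<close> would only be linearity over the reals.
\<close>

definition matrix_linear :: "('a::field^'m^'n \<Rightarrow> 'a^'m^'n) \<Rightarrow> bool" where
  "matrix_linear T \<longleftrightarrow> Vector_Spaces.linear matrix_scale matrix_scale T"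

definition GR :: "('a::field^'n^'n) set" where
  "GR = {R. R *v vec 1 = vec 1}"

definition gw_majorizes :: "'a::field^'m^'n \<Rightarrow> 'a^'m^'n \<Rightarrow> bool" (infix "\<succ>\<^sub>g\<^sub>w" 50) where
  "A \<succ>\<^sub>g\<^sub>w B \<longleftrightarrow> (\<exists>R\<in>GR. B = R ** A)"

definition strongly_preserves_gw :: "('a::field^'m^'n \<Rightarrow> 'a^'m^'n) \<Rightarrow> bool" where
  "strongly_preserves_gw T \<longleftrightarrow> (\<forall>X Y. X \<succ>\<^sub>g\<^sub>w Y \<longleftrightarrow> T X \<succ>\<^sub>g\<^sub>w T Y)"

lemma vector_space_matrix_scale:
  "vector_space (matrix_scale :: 'a::field \<Rightarrow> 'a^'m^'n \<Rightarrow> 'a^'m^'n)"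
  by unfold_locales
    (simp_all add: matrix_scale_def map_matrix_def vec_eq_iff algebra_simps)

lemma matrix_linear_iff:
  "matrix_linear T \<longleftrightarrow>
    (\<forall>X Y. T (X + Y) = T X + T Y) \<and> (\<forall>c X. T (matrix_scale c X) = matrix_scale c (T X))"
  unfolding matrix_linear_def
  by (simp add: Vector_Spaces.linear_iff vector_space_matrix_scale)

end

theory Submission
  imports Defs
begin

text \<open>
  The rows of the matrices that \<open>Z\<close> gw-majorizes are the affine combinations of the rows of \<open>Z\<close>.
  Hence the matrices majorizing only themselves are those with constant columns, \<open>e y\<^sup>t\<close>, and a
  strong preserver \<open>T\<close>, being bijective, sends \<open>e y\<^sup>t\<close> to \<open>e (g y)\<^sup>t\<close> with \<open>g\<close> linear and injective.
  If \<open>x\<close> is not constant, everything below \<open>x y\<^sup>t\<close> is either minimal or equivalent to \<open>x y\<^sup>t\<close>; so the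
  rows of \<open>T (x y\<^sup>t)\<close> lie on one line, which forces \<open>T (x y\<^sup>t) = c (g y)\<^sup>t\<close> for some \<open>c\<close>.
  Comparing \<open>y\<close>, \<open>y'\<close> and \<open>y + y'\<close> shows that \<open>c\<close> depends on \<open>x\<close> alone, say \<open>c = A x\<close>; in particular
  \<open>A e = e\<close>, and \<open>T X = A X B\<close> where \<open>B\<close> represents \<open>g\<close>.
\<close>

section \<open>Matrices of rank at most one, \<open>x y^t\<close>\<close>

definition outer :: "'a::field^'n \<Rightarrow> 'a^'m \<Rightarrow> 'a^'m^'n" where
  "outer x y = (\<chi> i j. x $ i * y $ j)"

text \<open>Expressed through majorization alone, so that a bijective strong preserver respects it
  in both directions.\<close>

definition gw_minimal :: "'a::field^'m^'n \<Rightarrow> bool" where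
  "gw_minimal Z \<longleftrightarrow> (\<forall>Y. Z \<succ>\<^sub>g\<^sub>w Y \<longrightarrow> Y = Z)"

lemma outer_nth [simp]: "outer x y $ i $ j = x $ i * y $ j"
  by (simp add: outer_def)

lemma outer_row: "outer x y $ i = x $ i *s y"
  by (simp add: vec_eq_iff)

lemma outer_zero [simp]: "outer 0 y = 0" "outer x 0 = 0"
  by (simp_all add: vec_eq_iff)

lemma outer_add_right: "outer x (y + z) = outer x y + outer x z"
  by (simp add: vec_eq_iff algebra_simps)

lemma outer_add_left: "outer (x + y) z = outer x z + outer y z"
  by (simp add: vec_eq_iff algebra_simps)

lemma outer_scale_left: "outer (c *s x) y = matrix_scale c (outer x y)"
  by (simp add: vec_eq_iff matrix_scale_def map_matrix_def)

lemma outer_scale_right: "outer x (c *s y) = matrix_scale c (outer x y)"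
  by (simp add: vec_eq_iff matrix_scale_def map_matrix_def)

lemma outer_eq_0_iff: "outer x y = 0 \<longleftrightarrow> x = 0 \<or> y = 0"
  by (auto simp: vec_eq_iff)

lemma matrix_mult_outer: "R ** outer x y = outer (R *v x) y"
  by (simp add: vec_eq_iff matrix_matrix_mult_def matrix_vector_mult_def sum_distrib_right mult.assoc)

lemma outer_mult_matrix: "outer x y ** B = outer x (y v* B)"
  by (simp add: vec_eq_iff matrix_matrix_mult_def vector_matrix_mult_def sum_distrib_left mult_ac)

lemma matrix_eq_sum_outer: "X = (\<Sum>j\<in>UNIV. outer (column j X) (axis j 1))"
  by (simp add: vec_eq_iff axis_def column_def if_distrib cong: if_cong)

lemma matrix_sum_mult:
  fixes A :: "'a::field^'n^'k" and f :: "'b \<Rightarrow> 'a^'m^'n" and B :: "'a^'l^'m"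
  shows "A ** sum f S ** B = (\<Sum>s\<in>S. A ** f s ** B)"
  by (induction S rule: infinite_finite_induct)
    (simp_all add: vec_eq_iff matrix_matrix_mult_def sum.distrib distrib_left distrib_right)

section \<open>Row sums and affine combinations of rows\<close>

lemma GR_iff: "R \<in> GR \<longleftrightarrow> (\<forall>i. (\<Sum>j\<in>UNIV. R $ i $ j) = 1)"
  by (simp add: GR_def vec_eq_iff matrix_vector_mult_def)

lemma mult_in_GR: "R \<in> GR \<Longrightarrow> S \<in> GR \<Longrightarrow> R ** S \<in> GR"
  by (simp add: GR_def flip: matrix_vector_mul_assoc)

lemma matrix_mult_row: "(R ** X) $ i = (\<Sum>j\<in>UNIV. R $ i $ j *s X $ j)"
  by (simp add: vec_eq_iff matrix_matrix_mult_def)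

text \<open>Row \<open>i\<close> of the witness puts weight \<open>c i\<close> on row
  \<open>p\<close> of \<open>Z\<close> and \<open>1 - c i\<close> on row \<open>q\<close>. The
  weights sum to 1, and since no sign is required \<open>c i\<close> ranges over the whole
  field.\<close>

lemma gw_majorizes_line:
  fixes Z :: "'a::field^'m^'n"
  assumes "\<And>i. Y $ i = Z $ q + c i *s (Z $ p - Z $ q)"
  shows "Z \<succ>\<^sub>g\<^sub>w Y"
proof -
  define R :: "'a^'n^'n" where "R = (\<chi> i. axis q 1 + c i *s (axis p 1 - axis q 1))"
  have s: "(\<Sum>j\<in>UNIV. axis k (1::'a) $ j * f j) = f k" for k :: 'n and f
    by (simp add: axis_def if_distrib if_distribR cong: if_cong)
  have "(\<Sum>j\<in>UNIV. R $ i $ j * f j) = f q + c i * (f p - f q)" for i f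
    by (simp add: R_def distrib_right left_diff_distrib right_diff_distrib mult.assoc
        sum.distrib sum_subtractf s flip: sum_distrib_left)
  note R = this
  have "R \<in> GR"
    unfolding GR_iff using R[where f = "\<lambda>_. 1"] by simp
  moreover have "Y = R ** Z"
    by (simp add: vec_eq_iff matrix_matrix_mult_def R assms right_diff_distrib)
  ultimately show ?thesis
    unfolding gw_majorizes_def by blast
qed

text \<open>Two distinct scalars affinely span the field, so every entry of \<open>x'\<close> is an
  affine combination of \<open>x $ p\<close> and \<open>x $ q\<close>.\<close>

lemma gw_majorizes_outer:
  assumes "x $ p \<noteq> x $ q"
  shows "outer x y \<succ>\<^sub>g\<^sub>w outer x' y"
proof (rule gw_majorizes_line)
  fix i
  define c where "c = (x' $ i - x $ q) / (x $ p - x $ q)"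
  have x': "x' $ i = x $ q + c * (x $ p - x $ q)"
    using assms by (simp add: c_def)
  show "outer x' y $ i = outer x y $ q + c *s (outer x y $ p - outer x y $ q)"
    unfolding outer_row x' by (simp add: vec_eq_iff algebra_simps)
qed

text \<open>Any row \<open>q\<close> can be copied into all positions, which a minimal
  \<open>Z\<close> must survive unchanged. Conversely, an affine combination of equal rows is that
  same row.\<close>

lemma gw_minimal_iff: "gw_minimal Z \<longleftrightarrow> (\<forall>p q. Z $ p = Z $ q)"
proof
  assume min: "gw_minimal Z"
  have "(\<chi> i. Z $ q) = Z" for q
    using min gw_majorizes_line[where c = "\<lambda>_. 0" and q = q and Z = Z and Y = "\<chi> i. Z $ q"]
    unfolding gw_minimal_def by simp
  then show "\<forall>p q. Z $ p = Z $ q"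
    by (metis vec_lambda_beta)
next
  assume const: "\<forall>p q. Z $ p = Z $ q"
  show "gw_minimal Z"
    unfolding gw_minimal_def
  proof (intro allI impI)
    fix Y assume "Z \<succ>\<^sub>g\<^sub>w Y"
    then obtain R where R: "R \<in> GR" "Y = R ** Z"
      by (auto simp: gw_majorizes_def)
    have "Y $ i = Z $ i" for i
    proof -
      have "Y $ i = (\<Sum>j\<in>UNIV. R $ i $ j *s Z $ i)"
        unfolding R(2) matrix_mult_row by (metis const)
      also have "\<dots> = (\<Sum>j\<in>UNIV. R $ i $ j) *s Z $ i"
        by (simp add: vec_eq_iff sum_distrib_right)
      finally show ?thesis
        using R(1) by (simp add: GR_iff)
    qed
    then show "Y = Z"
      by (simp add: vec_eq_iff)
  qed
qed

section \<open>Linear operators on matrices\<close>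

lemma matrix_linear_inj_imp_surj:
  fixes T :: "'a::field^'m^'n \<Rightarrow> 'a^'m^'n"
  assumes "matrix_linear T" "inj T"
  shows "surj T"
proof -
  \<comment> \<open>Reindexing by pairs turns \<open>T\<close> into an endomorphism of a
    finite-dimensional coordinate space, where injectivity gives surjectivity.\<close>
  define flat :: "'a^'m^'n \<Rightarrow> 'a^('n \<times> 'm)" where "flat X = (\<chi> k. X $ fst k $ snd k)" for X
  define unflat :: "'a^('n \<times> 'm) \<Rightarrow> 'a^'m^'n" where "unflat v = (\<chi> i j. v $ (i, j))" for v
  have fu [simp]: "flat (unflat v) = v" "unflat (flat X) = X" for v X
    by (simp_all add: flat_def unflat_def vec_eq_iff)
  have "unflat (v + w) = unflat v + unflat w" "unflat (c *s v) = matrix_scale c (unflat v)"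
    "flat (X + Y) = flat X + flat Y" "flat (matrix_scale c X) = c *s flat X" for v w c X Y
    by (simp_all add: flat_def unflat_def vec_eq_iff matrix_scale_def map_matrix_def)
  then have "Vector_Spaces.linear (*s) (*s) (flat \<circ> T \<circ> unflat)"
    using assms(1) by (simp add: Vector_Spaces.linear_iff vec.vector_space_axioms matrix_linear_iff)
  moreover have "inj (flat \<circ> T \<circ> unflat)"
    using assms(2) by (intro inj_compose) (auto intro: inj_on_inverseI[of _ flat] inj_on_inverseI[of _ unflat])
  ultimately have "surj (flat \<circ> T \<circ> unflat)"
    by (rule vec.linear_injective_imp_surjective) simp
  then have surj: "\<exists>v. flat Y = flat (T (unflat v))" for Y
    unfolding surj_def by simp
  have "\<exists>X. Y = T X" for Y
  proof -
    obtain v where "flat Y = flat (T (unflat v))"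
      using surj by blast
    then have "unflat (flat Y) = unflat (flat (T (unflat v)))"
      by (rule arg_cong)
    then show ?thesis
      by auto
  qed
  then show ?thesis
    unfolding surj_def by blast
qed

lemma matrix_linear_0: "matrix_linear T \<Longrightarrow> T 0 = 0"
  unfolding matrix_linear_iff by (metis add_cancel_right_right)

lemma matrix_linear_sum:
  assumes "matrix_linear T"
  shows "T (sum f S) = (\<Sum>i\<in>S. T (f i))"
  using assms matrix_linear_0[OF assms]
  by (induction S rule: infinite_finite_induct) (auto simp: matrix_linear_iff)

section \<open>Injectivity, minimal matrices and rank-one images of strong preservers\<close>

lemma gw_minimal_zero: "gw_minimal 0"
  by (simp add: gw_minimal_iff)

text \<open>If \<open>T X = T Y\<close> then \<open>T 0\<close> majorizes \<open>T (X - Y)\<close>,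
  both being zero; pulling this back, \<open>0\<close> majorizes \<open>X - Y\<close>, and
  \<open>0\<close> majorizes only itself.\<close>

lemma strong_preserver_inj:
  assumes lin: "matrix_linear T" and pres: "strongly_preserves_gw T"
  shows "inj T"
proof (rule injI)
  fix X Y assume eq: "T X = T Y"
  have "T (X - Y) = T X - T Y"
    using lin unfolding matrix_linear_iff by (metis add_diff_cancel diff_add_cancel)
  then have "T (X - Y) = T 0"
    using eq matrix_linear_0[OF lin] by simp
  moreover have "T 0 \<succ>\<^sub>g\<^sub>w T 0"
    by (rule gw_majorizes_line[where c = "\<lambda>_. 0"]) (simp add: matrix_linear_0[OF lin])
  ultimately have "0 \<succ>\<^sub>g\<^sub>w X - Y"
    using pres unfolding strongly_preserves_gw_def by metis
  then show "X = Y"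
    using gw_minimal_zero unfolding gw_minimal_def by (metis eq_iff_diff_eq_0)
qed

lemma strong_preserver_minimal_iff:
  assumes "strongly_preserves_gw T" "inj T" "surj T"
  shows "gw_minimal (T X) \<longleftrightarrow> gw_minimal X"
proof -
  have "gw_minimal (T X) \<longleftrightarrow> (\<forall>Y. T X \<succ>\<^sub>g\<^sub>w T Y \<longrightarrow> T Y = T X)"
    unfolding gw_minimal_def using \<open>surj T\<close> by (metis surjD)
  also have "\<dots> \<longleftrightarrow> gw_minimal X"
    using assms(1,2) by (simp add: gw_minimal_def strongly_preserves_gw_def inj_eq)
  finally show ?thesis .
qed

text \<open>With two row indices a nonconstant \<open>x\<close> exists. The images of all
  \<open>outer x y\<close> turn out to lie below one matrix \<open>W\<close> with only two distinct
  rows, hence have their rows on one line, and \<open>x = 0\<close> puts the origin on it.\<close>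

lemma strong_preserver_outer_line:
  fixes T :: "'a::field^'m^'n \<Rightarrow> 'a^'m^'n"
  assumes lin: "matrix_linear T" and pres: "strongly_preserves_gw T"
    and y: "y \<noteq> 0" and ij: "(i::'n) \<noteq> j"
  shows "\<exists>d. \<forall>x. \<exists>c. T (outer x y) = outer c d"
proof -
  note inj = strong_preserver_inj[OF lin pres]
  note surj = matrix_linear_inj_imp_surj[OF lin inj]
  note min_iff = strong_preserver_minimal_iff[OF pres inj surj]
  define X :: "'a^'m^'n" where "X = outer (axis i 1) y"
  have "X $ i \<noteq> X $ j"
    using y ij by (simp add: X_def outer_row axis_def)
  then have "\<not> gw_minimal (T X)"
    unfolding min_iff unfolding gw_minimal_iff by blast
  then obtain p q where pq: "T X $ p \<noteq> T X $ q"
    unfolding gw_minimal_iff by blast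
  define d where "d = T X $ p - T X $ q"
  \<comment> \<open>\<open>W\<close> keeps just two distinct rows of \<open>T X\<close>: it stays
    below \<open>T X\<close>, is not minimal, and confines everything below it to a line of
    direction \<open>d\<close>.\<close>
  define W :: "'a^'m^'n" where "W = (\<chi> k. if k = p then T X $ p else T X $ q)"
  have "p \<noteq> q"
    using pq by blast
  then have "W $ p \<noteq> W $ q"
    using pq by (simp add: W_def)
  then have "\<not> gw_minimal W"
    unfolding gw_minimal_iff by blast
  obtain Y where W: "W = T Y"
    using surj by blast
  have "T X \<succ>\<^sub>g\<^sub>w W"
    by (rule gw_majorizes_line[where c = "\<lambda>k. if k = p then 1 else 0" and p = p and q = q])
      (simp add: W_def)
  then have "X \<succ>\<^sub>g\<^sub>w Y"
    using pres by (simp add: W strongly_preserves_gw_def)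
  \<comment> \<open>Left multiplication changes only the column factor of
    \<open>outer (axis i 1) y\<close>.\<close>
  then obtain x' where Y: "Y = outer x' y"
    by (auto simp: gw_majorizes_def X_def matrix_mult_outer)
  have "\<not> gw_minimal Y"
    using \<open>\<not> gw_minimal W\<close> by (simp add: W min_iff)
  then obtain r s where "x' $ r \<noteq> x' $ s"
    unfolding Y unfolding gw_minimal_iff outer_row by metis
  then have "Y \<succ>\<^sub>g\<^sub>w outer x y" for x
    unfolding Y by (rule gw_majorizes_outer)
  then have maj: "W \<succ>\<^sub>g\<^sub>w T (outer x y)" for x
    using pres by (simp add: W strongly_preserves_gw_def)
  have line: "\<exists>c. \<forall>k. T (outer x y) $ k = T X $ q + c k *s d" for x
  proof -
    obtain R where R: "R \<in> GR" "T (outer x y) = R ** W"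
      using maj by (auto simp: gw_majorizes_def)
    have "T (outer x y) $ k = T X $ q + R $ k $ p *s d" for k
    proof -
      \<comment> \<open>Both rows of \<open>W\<close> share the base point \<open>T X $ q\<close>,
        which the row sum 1 of \<open>R\<close> preserves.\<close>
      have "W $ l = T X $ q + axis p 1 $ l *s d" for l
        by (simp add: W_def d_def axis_def)
      then have "T (outer x y) $ k = (\<Sum>l\<in>UNIV. R $ k $ l *s (T X $ q + axis p 1 $ l *s d))"
        by (simp add: R(2) matrix_mult_row)
      also have "\<dots> = (\<Sum>l\<in>UNIV. R $ k $ l) *s T X $ q + R $ k $ p *s d"
      proof -
        have "(\<Sum>l\<in>UNIV. R $ k $ l * (axis p 1 $ l * z)) = R $ k $ p * z" for z
          by (simp add: axis_def if_distrib if_distribR cong: if_cong)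
        then show ?thesis
          by (simp add: vec_eq_iff distrib_left sum.distrib sum_distrib_right mult.assoc)
      qed
      finally show ?thesis
        using R(1) by (simp add: GR_iff)
    qed
    then show ?thesis
      by (intro exI[of _ "\<lambda>k. R $ k $ p"]) simp
  qed
  \<comment> \<open>As \<open>T 0 = 0\<close>, the line passes through the origin, so its base point
    is a multiple of \<open>d\<close>.\<close>
  from line[of 0] obtain a where "0 = T X $ q + a *s d"
    by (auto simp: matrix_linear_0[OF lin])
  then have q: "T X $ q = (- a) *s d"
    by (simp add: vec_eq_iff eq_neg_iff_add_eq_0)
  have "\<exists>c. T (outer x y) = outer c d" for x
  proof -
    obtain c where "\<And>k. T (outer x y) $ k = T X $ q + c k *s d"
      using line by blast
    then have "T (outer x y) = outer (\<chi> k. c k - a) d"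
      unfolding q by (simp add: vec_eq_iff algebra_simps)
    then show ?thesis
      by blast
  qed
  then show ?thesis
    by blast
qed

section \<open>Construction of the two factors\<close>

lemma strong_preserver_form:
  fixes T :: "'a::field^'m^'n \<Rightarrow> 'a^'m^'n"
  assumes lin: "matrix_linear T" and pres: "strongly_preserves_gw T"
  shows "\<exists>A B. A \<in> GR \<and> invertible A \<and> invertible B \<and> (\<forall>X. T X = A ** X ** B)"
proof -
  note inj = strong_preserver_inj[OF lin pres]
  note surj = matrix_linear_inj_imp_surj[OF lin inj]
  note T0 = matrix_linear_0[OF lin]
  have T_add: "T (X + Y) = T X + T Y" and T_scale: "T (matrix_scale c X) = matrix_scale c (T X)"
    for X Y c
    using lin by (simp_all add: matrix_linear_iff)
  \<comment> \<open>An arbitrary row index: all rows of \<open>T (outer 1 y)\<close> are equal, so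
    the choice does not affect \<open>g\<close>.\<close>
  define i0 :: 'n where "i0 = undefined"
  define g where "g y = T (outer 1 y) $ i0" for y
  have T_1: "T (outer 1 y) = outer 1 (g y)" for y
  proof -
    have "gw_minimal (outer 1 y)"
      by (simp add: gw_minimal_iff outer_row)
    then have "gw_minimal (T (outer 1 y))"
      by (simp add: strong_preserver_minimal_iff[OF pres inj surj])
    then show ?thesis
      by (simp add: gw_minimal_iff g_def vec_eq_iff)
  qed
  have g_add: "g (y + z) = g y + g z" and g_scale: "g (c *s y) = c *s g y" for y z c
    by (simp_all add: g_def outer_add_right outer_scale_right T_add T_scale)
       (simp add: matrix_scale_def map_matrix_def vec_eq_iff)
  have g_eq_0: "y = 0" if "g y = 0" for y
  proof -
    have "T (outer 1 y) = T 0"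
      using T_1[of y] that T0 by simp
    then show ?thesis
      using inj by (auto simp: inj_eq outer_eq_0_iff)
  qed
  have T_outer: "\<exists>c. T (outer x y) = outer c (g y)" if y: "y \<noteq> 0" for x y
  proof (cases "\<exists>i j::'n. i \<noteq> j")
    case True
    then obtain d where d: "\<And>x. \<exists>c. T (outer x y) = outer c d"
      using strong_preserver_outer_line[OF lin pres y] by blast
    obtain a where "T (outer 1 y) = outer a d"
      using d by blast
    \<comment> \<open>\<open>g y\<close> is a nonzero multiple of \<open>d\<close>, so it can
      replace \<open>d\<close> as the direction.\<close>
    then have ga: "g y = a $ i0 *s d"
      by (simp add: g_def outer_row)
    have a: "a $ i0 \<noteq> 0"
      using g_eq_0[of y] y ga by auto
    obtain c where "T (outer x y) = outer c d"
      using d by blast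
    then have "T (outer x y) = outer ((1 / a $ i0) *s c) (g y)"
      using a by (simp add: ga vec_eq_iff)
    then show ?thesis
      by blast
  next
    case False
    \<comment> \<open>With a single row every \<open>x\<close> is a multiple of \<open>1\<close>,
      and \<open>T_1\<close> already decides the case.\<close>
    then have "x $ k = x $ i0" for k
      by (intro arg_cong[where f = "($) x"]) blast
    then have "x = x $ i0 *s 1"
      by (simp add: vec_eq_iff)
    then have "T (outer x y) = outer (x $ i0 *s 1) (g y)"
      by (metis T_1 T_scale outer_scale_left)
    then show ?thesis
      by blast
  qed
  define j0 :: 'm where "j0 = undefined"
  obtain l where l: "g (axis j0 1) $ l \<noteq> 0"
    using g_eq_0[of "axis j0 1"] by (metis axis_eq_0_iff one_neq_zero vec_eq_iff zero_index)
  \<comment> \<open>Dividing at a nonzero entry \<open>l\<close> of \<open>g (axis j0 1)\<close>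
    reads off the coefficient by a formula visibly linear in \<open>x\<close>.\<close>
  define f where "f x = (\<chi> i. T (outer x (axis j0 1)) $ i $ l / g (axis j0 1) $ l)" for x
  have f: "T (outer x (axis j0 1)) = outer (f x) (g (axis j0 1))" for x
  proof -
    obtain c where "T (outer x (axis j0 1)) = outer c (g (axis j0 1))"
      using T_outer[of "axis j0 1" x] by auto
    then show ?thesis
      using l by (simp add: f_def vec_eq_iff)
  qed
  \<comment> \<open>The coefficient must be the same for every axis vector: \<open>T\<close> at the
    sum of two of them has a single coefficient \<open>b\<close>, to be compared along independent
    directions.\<close>
  have f_unique: "c = f x" if c: "T (outer x (axis k 1)) = outer c (g (axis k 1))" for c x k
  proof (cases "k = j0")
    case True
    then show ?thesis
      using c l by (simp add: f_def)
  next
    case False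
    \<comment> \<open>\<open>g\<close> is linear with trivial kernel, so it keeps distinct axis
      vectors independent.\<close>
    have indep: "a = 0 \<and> b = 0" if "a *s g (axis j0 1) + b *s g (axis k 1) = 0" for a b
    proof -
      have "g (a *s axis j0 1 + b *s axis k 1) = 0"
        using that by (simp add: g_add g_scale)
      then have 0: "a *s axis j0 1 + b *s axis k 1 = 0"
        by (rule g_eq_0)
      show ?thesis
        using arg_cong[OF 0, of "\<lambda>v. v $ j0"] arg_cong[OF 0, of "\<lambda>v. v $ k"] False
        by (auto simp: axis_def)
    qed
    have "axis j0 1 + axis k (1::'a) \<noteq> 0"
      using False by (auto simp: vec_eq_iff axis_def intro!: exI[of _ k])
    then obtain b where "T (outer x (axis j0 1 + axis k 1)) = outer b (g (axis j0 1 + axis k 1))"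
      using T_outer by blast
    then have b: "outer (f x) (g (axis j0 1)) + outer c (g (axis k 1))
        = outer b (g (axis j0 1)) + outer b (g (axis k 1))"
      by (simp add: outer_add_right g_add T_add f c)
    have "f x $ i = b $ i \<and> c $ i = b $ i" for i
      using indep[of "f x $ i - b $ i" "c $ i - b $ i"] arg_cong[OF b, of "\<lambda>M. M $ i"]
      by (simp add: outer_row vec_eq_iff algebra_simps)
    then show ?thesis
      by (simp add: vec_eq_iff)
  qed
  have f_axis: "T (outer x (axis k 1)) = outer (f x) (g (axis k 1))" for x k
  proof -
    obtain c where "T (outer x (axis k 1)) = outer c (g (axis k 1))"
      using T_outer[of "axis k 1" x] by auto
    then show ?thesis
      using f_unique by blast
  qed
  have "Vector_Spaces.linear (*s) (*s) f"
    by (simp add: Vector_Spaces.linear_iff vec.vector_space_axioms f_def vec_eq_iff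
        outer_add_left outer_scale_left T_add T_scale add_divide_distrib)
      (simp add: matrix_scale_def map_matrix_def)
  then have A: "matrix f *v x = f x" for x
    by (rule matrix_works)
  \<comment> \<open>The images of the axis vectors are the rows of \<open>B\<close>, since
    \<open>B\<close> acts on row vectors from the right.\<close>
  define B :: "'a^'m^'m" where "B = (\<chi> k. g (axis k 1))"
  have B: "axis k 1 v* B = g (axis k 1)" for k
    by (simp add: B_def vec_eq_iff vector_matrix_mult_def axis_def if_distrib if_distribR
        cong: if_cong)
  have T: "T X = matrix f ** X ** B" for X
  proof -
    have "T X = T (\<Sum>k\<in>UNIV. outer (column k X) (axis k 1))"
      by (rule arg_cong[OF matrix_eq_sum_outer])
    also have "\<dots> = (\<Sum>k\<in>UNIV. T (outer (column k X) (axis k 1)))"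
      by (rule matrix_linear_sum[OF lin])
    also have "\<dots> = (\<Sum>k\<in>UNIV. matrix f ** outer (column k X) (axis k 1) ** B)"
      by (simp add: f_axis matrix_mult_outer outer_mult_matrix A B)
    also have "\<dots> = matrix f ** (\<Sum>k\<in>UNIV. outer (column k X) (axis k 1)) ** B"
      by (simp add: matrix_sum_mult)
    also have "(\<Sum>k\<in>UNIV. outer (column k X) (axis k 1)) = X"
      by (rule matrix_eq_sum_outer[symmetric])
    finally show ?thesis .
  qed
  \<comment> \<open>Injectivity of \<open>T\<close> on rank-one matrices; fixing one nonzero factor
    yields the invertibility of the other matrix.\<close>
  have ker: "x = 0 \<or> y = 0" if "outer (matrix f *v x) (y v* B) = 0" for x y
  proof -
    have "T (outer x y) = T 0"
      using that by (simp add: T0) (simp add: T matrix_mult_outer outer_mult_matrix)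
    then show ?thesis
      using inj by (simp add: inj_eq outer_eq_0_iff)
  qed
  have "x = 0" if "matrix f *v x = 0" for x
    using ker[of x "axis j0 1"] that by simp
  then have "invertible (matrix f)"
    unfolding invertible_left_inverse matrix_left_invertible_ker by blast
  \<comment> \<open>The kernel of \<open>y v* B\<close> is that of \<open>transpose B\<close>; a
    left inverse of the transpose gives a right inverse of \<open>B\<close>.\<close>
  moreover have "y = 0" if "transpose B *v y = 0" for y
    using ker[of 1 y] that by (simp add: vec_eq_iff)
  then have "\<exists>M. M ** transpose B = mat 1"
    unfolding matrix_left_invertible_ker by simp
  then obtain M where "M ** transpose B = mat 1" ..
  then have "transpose (M ** transpose B) = mat 1"
    by simp
  then have "B ** transpose M = mat 1"
    by (simp add: matrix_transpose_mul)
  then have "invertible B"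
    unfolding invertible_right_inverse by blast
  \<comment> \<open>\<open>T_1\<close> exhibits \<open>1\<close> as a coefficient for
    \<open>x = 1\<close>, so uniqueness applies.\<close>
  moreover have "f 1 = 1"
    using f_unique[of 1 j0 1] T_1 by simp
  then have "matrix f \<in> GR"
    by (simp add: GR_def A)
  ultimately show ?thesis
    using T by (intro exI[of _ "matrix f"] exI[of _ B]) simp
qed

section \<open>The converse and the equivalence\<close>

lemma strongly_preserves_gw_mult:
  fixes T :: "'a::field^'m^'n \<Rightarrow> 'a^'m^'n"
  assumes A: "A \<in> GR" "invertible A" and B: "invertible B" and T: "\<And>X. T X = A ** X ** B"
  shows "strongly_preserves_gw T"
proof -
  obtain A' where A': "A ** A' = mat 1" "A' ** A = mat 1"
    using A(2) by (auto simp: invertible_def)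
  obtain B' where B': "B ** B' = mat 1"
    using B by (auto simp: invertible_def)
  \<comment> \<open>Applying \<open>A'\<close> to \<open>A *v vec 1 = vec 1\<close> gives the same
    equation for \<open>A'\<close>.\<close>
  have A'_GR: "A' \<in> GR"
    using A(1) A' unfolding GR_def
    by (metis (mono_tags, lifting) matrix_vector_mul_assoc matrix_vector_mul_lid mem_Collect_eq)
  have "X \<succ>\<^sub>g\<^sub>w Y \<longleftrightarrow> T X \<succ>\<^sub>g\<^sub>w T Y" for X Y
  proof
    assume "X \<succ>\<^sub>g\<^sub>w Y"
    then obtain R where R: "R \<in> GR" "Y = R ** X"
      by (auto simp: gw_majorizes_def)
    \<comment> \<open>Inserting \<open>A' ** A\<close> exposes \<open>T X\<close>: the witness for
      the images is the conjugate of \<open>R\<close> by \<open>A\<close>, again in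
      \<open>GR\<close>.\<close>
    have "T Y = A ** R ** (A' ** A) ** X ** B"
      by (simp add: T R(2) A' matrix_mul_assoc)
    then have "T Y = (A ** R ** A') ** T X"
      by (simp add: T matrix_mul_assoc)
    then show "T X \<succ>\<^sub>g\<^sub>w T Y"
      using mult_in_GR A(1) R(1) A'_GR unfolding gw_majorizes_def by blast
  next
    assume "T X \<succ>\<^sub>g\<^sub>w T Y"
    then obtain R where R: "R \<in> GR" "T Y = R ** T X"
      by (auto simp: gw_majorizes_def)
    have "Y = (A' ** A) ** Y ** (B ** B')"
      by (simp add: A' B')
    also have "\<dots> = A' ** T Y ** B'"
      by (simp add: T matrix_mul_assoc)
    also have "\<dots> = (A' ** R ** A) ** X ** (B ** B')"
      by (simp add: R(2)) (simp add: T matrix_mul_assoc)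
    finally have "Y = (A' ** R ** A) ** X"
      by (simp add: B')
    then show "X \<succ>\<^sub>g\<^sub>w Y"
      using mult_in_GR A(1) R(1) A'_GR unfolding gw_majorizes_def by blast
  qed
  then show ?thesis
    by (simp add: strongly_preserves_gw_def)
qed

lemma strongly_preserves_gw_iff:
  fixes T :: "'a::field^'m^'n \<Rightarrow> 'a^'m^'n"
  assumes "matrix_linear T"
  shows "strongly_preserves_gw T \<longleftrightarrow>
    (\<exists>A B. A \<in> GR \<and> invertible A \<and> invertible B \<and> (\<forall>X. T X = A ** X ** B))"
proof
  assume "strongly_preserves_gw T"
  with assms show "\<exists>A B. A \<in> GR \<and> invertible A \<and> invertible B \<and> (\<forall>X. T X = A ** X ** B)"
    by (rule strong_preserver_form)
next
  assume "\<exists>A B. A \<in> GR \<and> invertible A \<and> invertible B \<and> (\<forall>X. T X = A ** X ** B)"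
  then show "strongly_preserves_gw T"
    by (elim exE conjE) (rule strongly_preserves_gw_mult, simp_all)
qed

theorem theorem2p9:
  fixes T\<^sub>R :: "real^'m::finite^'n::finite \<Rightarrow> real^'m^'n"
    and T\<^sub>C :: "complex^'m^'n \<Rightarrow> complex^'m^'n"
  shows "(matrix_linear T\<^sub>R \<longrightarrow>
            (strongly_preserves_gw T\<^sub>R \<longleftrightarrow>
              (\<exists>A B. A \<in> GR \<and> invertible A \<and> invertible B \<and> (\<forall>X. T\<^sub>R X = A ** X ** B)))) \<and>
         (matrix_linear T\<^sub>C \<longrightarrow>
            (strongly_preserves_gw T\<^sub>C \<longleftrightarrow>
              (\<exists>A B. A \<in> GR \<and> invertible A \<and> invertible B \<and> (\<forall>X. T\<^sub>C X = A ** X ** B))))"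
  by (intro conjI impI strongly_preserves_gw_iff)

end
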